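(* Let $n\in\mathbb N$. For every positive $n\times n$ diagonal matrix $D$ there exists a positive linear operator $X\colon \ell^2_n\to L^2[0,1]$ such that $X^*X=D$. Furthermore, there exists a positive self-adjoint operator $Y\colon L^2[0,1]\to L^2[0,1]$ such that $Y^2=XX^*$.
   Context: $\ell^2_n$ is $\mathbb R^n$ with the Euclidean norm and coordinatewise order, and $L^2[0,1]$ (Lebesgue measure, real functions, almost everywhere order) is regarded as a Hilbert lattice; $X^*$ denotes the Hilbert space adjoint. A linear operator between vector lattices is positive if it maps the positive cone into the positive cone; in particular a diagonal matrix is positive if its diagonal entries are non-negative. *)

theory Defs
  imports "HOL-Analysis.Analysis"
begin

section \<open>The space of square-integrable functions on the unit interval\<close>

abbreviation unit_leb :: "real measure"
  where "unit_leb \<equiv> lebesgue_on {0..1}"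

definition square_integrable :: "(real \<Rightarrow> real) \<Rightarrow> bool"
  where "square_integrable f \<longleftrightarrow>
    f \<in> borel_measurable unit_leb \<and> integrable unit_leb (\<lambda>x. (f x)\<^sup>2)"

lemma square_integrable_measurable [measurable_dest]:
  "square_integrable f \<Longrightarrow> f \<in> borel_measurable unit_leb"
  by (simp add: square_integrable_def)

lemma square_integrable_mult:
  assumes "square_integrable f" "square_integrable g"
  shows "integrable unit_leb (\<lambda>x. f x * g x)"
proof (rule Bochner_Integration.integrable_bound)
  show "integrable unit_leb (\<lambda>x. (f x)\<^sup>2 + (g x)\<^sup>2)"
    using assms by (auto simp: square_integrable_def)
  show "(\<lambda>x. f x * g x) \<in> borel_measurable unit_leb"
    using assms by (auto simp: square_integrable_def)
  have "\<bar>a * b\<bar> \<le> a\<^sup>2 + b\<^sup>2" for a b :: real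
  proof -
    have "2 * (\<bar>a\<bar> * \<bar>b\<bar>) \<le> \<bar>a\<bar>\<^sup>2 + \<bar>b\<bar>\<^sup>2"
      using sum_squares_bound[of "\<bar>a\<bar>" "\<bar>b\<bar>"] by simp
    moreover have "0 \<le> \<bar>a\<bar> * \<bar>b\<bar>" by simp
    ultimately show ?thesis unfolding abs_mult power2_abs by linarith
  qed
  then show "AE x in unit_leb. norm (f x * g x) \<le> norm ((f x)\<^sup>2 + (g x)\<^sup>2)"
    by (intro AE_I2) auto
qed

lemma square_integrable_zero: "square_integrable (\<lambda>_. 0)"
  by (simp add: square_integrable_def)

lemma square_integrable_add:
  assumes "square_integrable f" "square_integrable g"
  shows "square_integrable (\<lambda>x. f x + g x)"
proof -
  have "integrable unit_leb (\<lambda>x. (f x)\<^sup>2 + (g x)\<^sup>2 + 2 * (f x * g x))"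
    using assms square_integrable_mult[OF assms]
    by (intro Bochner_Integration.integrable_add integrable_mult_right)
       (auto simp: square_integrable_def)
  then show ?thesis
    using assms by (auto simp: square_integrable_def power2_sum mult.assoc)
qed

lemma square_integrable_scale:
  "square_integrable f \<Longrightarrow> square_integrable (\<lambda>x. c * f x)"
  by (auto simp: square_integrable_def power_mult_distrib)

lemma square_integrable_abs:
  "square_integrable f \<Longrightarrow> square_integrable (\<lambda>x. \<bar>f x\<bar>)"
  by (auto simp: square_integrable_def)

lemma square_integrable_uminus:
  "square_integrable f \<Longrightarrow> square_integrable (\<lambda>x. - f x)"
  using square_integrable_scale[of f "-1"] by simp

lemma square_integrable_diff:
  "square_integrable f \<Longrightarrow> square_integrable g \<Longrightarrow> square_integrable (\<lambda>x. f x - g x)"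
  using square_integrable_add[of f "\<lambda>x. - g x"] square_integrable_uminus[of g] by simp

lemma square_integrable_max:
  assumes "square_integrable f" "square_integrable g"
  shows "square_integrable (\<lambda>x. max (f x) (g x))"
proof -
  have "(\<lambda>x. max (f x) (g x)) = (\<lambda>x. (1/2) * ((f x + g x) + \<bar>f x - g x\<bar>))"
    by (auto simp: fun_eq_iff max_def)
  then show ?thesis
    using assms by (simp only:) (intro square_integrable_scale square_integrable_add
        square_integrable_abs square_integrable_diff)
qed

lemma square_integrable_min:
  assumes "square_integrable f" "square_integrable g"
  shows "square_integrable (\<lambda>x. min (f x) (g x))"
proof -
  have "(\<lambda>x. min (f x) (g x)) = (\<lambda>x. - max (- f x) (- g x))"
    by (auto simp: fun_eq_iff min_def max_def)
  then show ?thesis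
    using assms by (simp only:) (intro square_integrable_uminus square_integrable_max)
qed

definition L2_rel :: "(real \<Rightarrow> real) \<Rightarrow> (real \<Rightarrow> real) \<Rightarrow> bool"
  where "L2_rel f g \<longleftrightarrow> square_integrable f \<and> square_integrable g \<and> (AE x in unit_leb. f x = g x)"

lemma part_equivp_L2_rel: "part_equivp L2_rel"
proof (rule part_equivpI)
  show "\<exists>f. L2_rel f f"
    by (rule exI[of _ "\<lambda>_. 0"]) (simp add: L2_rel_def square_integrable_zero)
  show "symp L2_rel"
    by (auto simp: symp_def L2_rel_def elim: eventually_mono)
  show "transp L2_rel"
    by (auto simp: transp_def L2_rel_def elim: eventually_elim2)
qed

quotient_type L2 = "real \<Rightarrow> real" / partial: L2_rel
  by (rule part_equivp_L2_rel)

instantiation L2 :: real_vector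
begin

lift_definition zero_L2 :: L2 is "\<lambda>_. 0"
  by (simp add: L2_rel_def square_integrable_zero)

lift_definition plus_L2 :: "L2 \<Rightarrow> L2 \<Rightarrow> L2" is "\<lambda>f g x. f x + g x"
  unfolding L2_rel_def by (auto intro: square_integrable_add elim: eventually_elim2)

lift_definition minus_L2 :: "L2 \<Rightarrow> L2 \<Rightarrow> L2" is "\<lambda>f g x. f x - g x"
  unfolding L2_rel_def by (auto intro: square_integrable_diff elim: eventually_elim2)

lift_definition uminus_L2 :: "L2 \<Rightarrow> L2" is "\<lambda>f x. - f x"
  unfolding L2_rel_def by (auto intro: square_integrable_uminus)

lift_definition scaleR_L2 :: "real \<Rightarrow> L2 \<Rightarrow> L2" is "\<lambda>c f x. c * f x"
  unfolding L2_rel_def by (auto intro: square_integrable_scale elim: eventually_mono)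

instance
  by standard
    (transfer; auto simp: L2_rel_def algebra_simps
      intro!: square_integrable_add square_integrable_diff square_integrable_uminus
        square_integrable_scale square_integrable_zero)+

end

instantiation L2 :: real_inner
begin

lift_definition inner_L2 :: "L2 \<Rightarrow> L2 \<Rightarrow> real" is "\<lambda>f g. \<integral>x. f x * g x \<partial>unit_leb"
  unfolding L2_rel_def
  by (intro integral_cong_AE) (auto elim: eventually_elim2)

definition norm_L2 :: "L2 \<Rightarrow> real"
  where "norm_L2 f = sqrt (inner f f)"

definition sgn_L2 :: "L2 \<Rightarrow> L2"
  where "sgn_L2 f = f /\<^sub>R norm f"

definition dist_L2 :: "L2 \<Rightarrow> L2 \<Rightarrow> real"
  where "dist_L2 f g = norm (f - g)"

definition uniformity_L2 :: "(L2 \<times> L2) filter"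
  where "uniformity_L2 = (INF e\<in>{0<..}. principal {(f, g). dist f g < e})"

definition open_L2 :: "L2 set \<Rightarrow> bool"
  where "open_L2 U = (\<forall>f\<in>U. eventually (\<lambda>(f', g). f' = f \<longrightarrow> g \<in> U) uniformity)"

instance
proof
  fix f g h :: L2 and c :: real and U :: "L2 set"
  show "dist f g = norm (f - g)" by (rule dist_L2_def)
  show "sgn f = f /\<^sub>R norm f" by (rule sgn_L2_def)
  show "uniformity = (INF e\<in>{0<..}. principal {(f, g :: L2). dist f g < e})"
    by (rule uniformity_L2_def)
  show "open U = (\<forall>f\<in>U. \<forall>\<^sub>F (f', g) in uniformity. f' = f \<longrightarrow> g \<in> U)"
    by (rule open_L2_def)
  show "norm f = sqrt (inner f f)" by (rule norm_L2_def)
  show "inner f g = inner g f"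
    by transfer (simp add: mult.commute)
  show "inner (f + g) h = inner f h + inner g h"
    by transfer (simp add: L2_rel_def distrib_right square_integrable_mult)
  show "inner (c *\<^sub>R f) g = c * inner f g"
    by transfer (simp add: L2_rel_def mult.assoc)
  show "0 \<le> inner f f"
    by transfer (intro Bochner_Integration.integral_nonneg, simp)
  show "inner f f = 0 \<longleftrightarrow> f = 0"
  proof transfer
    fix f assume "L2_rel f f"
    then have f: "square_integrable f" by (simp add: L2_rel_def)
    have "(\<integral>x. f x * f x \<partial>unit_leb) = 0 \<longleftrightarrow> (AE x in unit_leb. f x * f x = 0)"
      by (intro integral_nonneg_eq_0_iff_AE square_integrable_mult f) simp
    then show "(\<integral>x. f x * f x \<partial>unit_leb) = 0 \<longleftrightarrow> L2_rel f (\<lambda>_. 0)"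
      using f by (simp add: L2_rel_def square_integrable_zero)
  qed
qed

end

instantiation L2 :: "{lattice, ordered_real_vector}"
begin

lift_definition less_eq_L2 :: "L2 \<Rightarrow> L2 \<Rightarrow> bool" is "\<lambda>f g. AE x in unit_leb. f x \<le> g x"
proof -
  fix f f' g g' assume "L2_rel f f'" "L2_rel g g'"
  then have "AE x in unit_leb. f x = f' x \<and> g x = g' x"
    by (simp add: L2_rel_def)
  then have "AE x in unit_leb. f x \<le> g x \<longleftrightarrow> f' x \<le> g' x"
    by (auto elim: eventually_mono)
  then show "(AE x in unit_leb. f x \<le> g x) \<longleftrightarrow> (AE x in unit_leb. f' x \<le> g' x)"
    by (rule eventually_cong) simp
qed

definition less_L2 :: "L2 \<Rightarrow> L2 \<Rightarrow> bool"
  where "less_L2 f g \<longleftrightarrow> f \<le> g \<and> \<not> g \<le> f"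

lift_definition sup_L2 :: "L2 \<Rightarrow> L2 \<Rightarrow> L2" is "\<lambda>f g x. max (f x) (g x)"
  unfolding L2_rel_def by (auto intro: square_integrable_max elim: eventually_elim2)

lift_definition inf_L2 :: "L2 \<Rightarrow> L2 \<Rightarrow> L2" is "\<lambda>f g x. min (f x) (g x)"
  unfolding L2_rel_def by (auto intro: square_integrable_min elim: eventually_elim2)

instance
proof
  fix f g h :: L2 and a b :: real
  show "f < g \<longleftrightarrow> f \<le> g \<and> \<not> g \<le> f" by (rule less_L2_def)
  show "f \<le> f" by transfer simp
  show "f \<le> g \<Longrightarrow> g \<le> h \<Longrightarrow> f \<le> h"
    by transfer (erule (1) eventually_elim2, simp)
  show "f \<le> g \<Longrightarrow> g \<le> f \<Longrightarrow> f = g"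
    by transfer (auto simp: L2_rel_def elim: eventually_elim2)
  show "inf f g \<le> f" "inf f g \<le> g" "f \<le> sup f g" "g \<le> sup f g"
    by (transfer, simp)+
  show "f \<le> g \<Longrightarrow> f \<le> h \<Longrightarrow> f \<le> inf g h"
    by transfer (erule (1) eventually_elim2, simp)
  show "g \<le> f \<Longrightarrow> h \<le> f \<Longrightarrow> sup g h \<le> f"
    by transfer (erule (1) eventually_elim2, simp)
  show "f \<le> g \<Longrightarrow> h + f \<le> h + g" by transfer simp
  show "f \<le> g \<Longrightarrow> 0 \<le> a \<Longrightarrow> a *\<^sub>R f \<le> a *\<^sub>R g"
    by transfer (auto elim!: eventually_mono intro: mult_left_mono)
  show "a \<le> b \<Longrightarrow> 0 \<le> f \<Longrightarrow> a *\<^sub>R f \<le> b *\<^sub>R f"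
    by transfer (auto elim!: eventually_mono intro: mult_right_mono)
qed

end


section \<open>Positive and self-adjoint operators\<close>

text \<open>Positivity is meant in the order-theoretic sense, not as positive semidefiniteness.
  The domain and codomain carry their own order: coordinatewise on \<^typ>\<open>real ^ 'n\<close>,
  almost everywhere on \<^typ>\<open>L2\<close>.\<close>

definition positive_operator ::
    "('a :: {real_vector, ord} \<Rightarrow> 'b :: {real_vector, ord}) \<Rightarrow> bool"
  where "positive_operator T \<longleftrightarrow> linear T \<and> (\<forall>x\<ge>0. T x \<ge> 0)"

text \<open>The library constant \<^const>\<open>adjoint\<close> is a choice operator, and meaningful only for maps that
  have an adjoint. This holds for linear maps from a Euclidean space (\<open>adjoint_works\<close>), but on
  \<^typ>\<open>L2\<close> the equation \<open>adjoint Y = Y\<close> alone would not guarantee that \<open>Y\<close> is symmetric.\<close>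

definition self_adjoint :: "('a :: real_inner \<Rightarrow> 'a) \<Rightarrow> bool"
  where "self_adjoint Y \<longleftrightarrow> bounded_linear Y \<and> (\<forall>x y. inner (Y x) y = inner x (Y y))"

lemma self_adjoint_adjoint: "self_adjoint Y \<Longrightarrow> adjoint Y = Y"
  by (rule adjoint_unique) (simp add: self_adjoint_def)

definition diagonal_matrix :: "real ^ 'n ^ 'n \<Rightarrow> bool"
  where "diagonal_matrix D \<longleftrightarrow> (\<forall>i j. i \<noteq> j \<longrightarrow> D $ i $ j = 0)"

lemma diagonal_matrix_mult_nth:
  "diagonal_matrix D \<Longrightarrow> (D *v x) $ i = D $ i $ i * x $ i"
  unfolding diagonal_matrix_def matrix_vector_mult_def
  by (simp add: sum.remove[of UNIV i])

lemma positive_operator_diagonal_iff: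
  fixes D :: "real ^ 'n ^ 'n"
  assumes "diagonal_matrix D"
  shows "positive_operator ((*v) D) \<longleftrightarrow> (\<forall>i. D $ i $ i \<ge> 0)"
proof
  assume pos: "positive_operator ((*v) D)"
  show "\<forall>i. D $ i $ i \<ge> 0"
  proof
    fix i
    have "(axis i 1 :: real ^ 'n) \<ge> 0" by (simp add: less_eq_vec_def axis_def)
    then have "D *v axis i 1 \<ge> 0" using pos by (simp add: positive_operator_def)
    then have "(D *v axis i 1) $ i \<ge> 0" by (simp add: less_eq_vec_def)
    then show "D $ i $ i \<ge> 0"
      by (simp add: diagonal_matrix_mult_nth[OF assms])
  qed
next
  assume "\<forall>i. D $ i $ i \<ge> 0"
  then show "positive_operator ((*v) D)"
    by (simp add: positive_operator_def less_eq_vec_def diagonal_matrix_mult_nth[OF assms])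
qed

end

theory Submission
  imports Defs
begin

text \<open>The idea is to embed Euclidean space into \<open>L\<^sup>2[0,1]\<close> along an orthonormal family \<open>e\<close> of
  \<^emph>\<open>non-negative\<close> functions; disjointness of supports gives orthogonality without changes of sign,
  so normalised indicators of disjoint intervals will do (\<open>normalized_indicator\<close>). If \<open>D\<close> has the
  diagonal entries \<open>d\<^sub>i \<ge> 0\<close>, let \<open>X\<close> send the \<open>i\<close>-th unit vector to \<open>\<surd>d\<^sub>i e\<^sub>i\<close>; this is
  \<open>embed_op\<close> with coefficients \<open>\<surd>d\<^sub>i\<close>. Its adjoint is \<open>f \<mapsto> (\<surd>d\<^sub>i \<langle>e\<^sub>i, f\<rangle>)\<^sub>i\<close>, so
  orthonormality gives \<open>X\<^sup>*X = D\<close>, whereas \<open>XX\<^sup>*\<close> is the operator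
  \<open>f \<mapsto> \<Sum>\<^sub>i d\<^sub>i \<langle>e\<^sub>i, f\<rangle> e\<^sub>i\<close>, diagonal with respect to \<open>e\<close>. Such operators compose by
  multiplying coefficients (\<open>diag_op_comp\<close>), so taking the square roots of the \<open>d\<^sub>i\<close> gives \<open>Y\<close>. It
  is positive in the order sense because both \<open>\<langle>e\<^sub>i, \<cdot>\<rangle>\<close> and \<open>e\<^sub>i\<close> are.\<close>

text \<open>One infinite sequence of disjoint intervals serves every dimension: an arbitrary injection of
  the finite index set into the naturals selects the intervals that are used.\<close>

definition slot :: "nat \<Rightarrow> real set"
  where "slot k = {1 / real (k + 2)<..1 / real (k + 1)}"

lemma slot_disjoint:
  assumes "j \<noteq> k"
  shows "slot j \<inter> slot k = {}"
proof -
  have less: "slot j \<inter> slot k = {}" if "j < k" for j k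
  proof -
    have "1 / real (k + 1) \<le> 1 / real (j + 2)"
      using that by (intro divide_left_mono) auto
    then show ?thesis by (auto simp: slot_def)
  qed
  show ?thesis
    using less[of j k] less[of k j] assms by (cases j k rule: linorder_cases) auto
qed

lemma slot_subset: "slot k \<subseteq> {0..1}"
proof
  fix x assume x: "x \<in> slot k"
  have "1 / real (k + 1) \<le> 1" "0 \<le> 1 / real (k + 2)" by simp_all
  then show "x \<in> {0..1}"
    using x unfolding slot_def greaterThanAtMost_iff atLeastAtMost_iff by linarith
qed

lemma slot_sets [measurable]: "slot k \<in> sets unit_leb"
proof -
  have "slot k \<in> sets lebesgue" by (simp add: slot_def)
  then show ?thesis
    using slot_subset by (simp add: sets_restrict_space_iff)
qed

lemma measure_slot: "measure unit_leb (slot k) = 1 / (real (k + 1) * real (k + 2))"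
proof -
  have "measure unit_leb (slot k) = measure lebesgue (slot k)"
    using slot_subset by (simp add: measure_restrict_space)
  also have "\<dots> = 1 / real (k + 1) - 1 / real (k + 2)"
    unfolding slot_def
    by (subst measure_completion) (auto simp: measure_def emeasure_lborel_Ioc divide_left_mono)
  finally show ?thesis by (simp add: field_simps)
qed

lemma integral_slot: "(\<integral>x. c * indicator (slot k) x \<partial>unit_leb) = c * measure unit_leb (slot k)"
  using slot_subset[of k] by (simp add: Int_absorb2)

lift_definition normalized_indicator :: "nat \<Rightarrow> L2"
  is "\<lambda>k x. sqrt (real (k + 1) * real (k + 2)) * indicator (slot k) x"
proof -
  fix k
  have "finite_measure unit_leb"
    by (rule finite_measure_lebesgue_on) auto
  then have "integrable unit_leb (\<lambda>x. (indicator (slot k) x :: real))"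
    using slot_subset
    by (simp add: integrable_indicator_iff finite_measure.emeasure_finite
        top.not_eq_extremum[symmetric] Int_absorb2)
  then have "square_integrable (indicator (slot k))"
    by (simp add: square_integrable_def power2_eq_square flip: indicator_inter_arith)
  then show "L2_rel (\<lambda>x. sqrt (real (k + 1) * real (k + 2)) * indicator (slot k) x)
      (\<lambda>x. sqrt (real (k + 1) * real (k + 2)) * indicator (slot k) x)"
    by (simp add: L2_rel_def square_integrable_scale)
qed

lemma normalized_indicator_nonneg: "0 \<le> normalized_indicator k"
  by transfer simp

lemma normalized_indicator_orthonormal:
  "inner (normalized_indicator j) (normalized_indicator k) = (if j = k then 1 else 0)"
proof transfer
  fix j k
  let ?c = "\<lambda>k. sqrt (real (k + 1) * real (k + 2))"
  have "(?c j * indicator (slot j) x) * (?c k * indicator (slot k) x)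
      = (if j = k then real (k + 1) * real (k + 2) else 0) * indicator (slot k) x" for x
    using slot_disjoint[of j k] by (auto simp: indicator_def)
  then have "(\<integral>x. (?c j * indicator (slot j) x) * (?c k * indicator (slot k) x) \<partial>unit_leb)
      = (if j = k then real (k + 1) * real (k + 2) else 0) * measure unit_leb (slot k)"
    by (simp only: integral_slot)
  then show "(\<integral>x. (?c j * indicator (slot j) x) * (?c k * indicator (slot k) x) \<partial>unit_leb)
      = (if j = k then 1 else 0)"
    by (simp add: measure_slot)
qed

definition diag_op :: "('n::finite \<Rightarrow> 'a::real_inner) \<Rightarrow> ('n \<Rightarrow> real) \<Rightarrow> 'a \<Rightarrow> 'a"
  where "diag_op e c f = (\<Sum>i\<in>UNIV. (c i * inner (e i) f) *\<^sub>R e i)"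

lemma bounded_linear_diag_op: "bounded_linear (diag_op e c)"
  unfolding diag_op_def
  by (intro bounded_linear_sum bounded_linear_scaleR_const bounded_linear_const_mult
      bounded_linear_inner_right)

lemma self_adjoint_diag_op: "self_adjoint (diag_op e c)"
  unfolding self_adjoint_def using bounded_linear_diag_op
  by (auto simp: diag_op_def inner_sum_left inner_sum_right inner_commute mult_ac)

lemma inner_orthonormal_sum:
  fixes e :: "'n::finite \<Rightarrow> 'a::real_inner"
  assumes "\<And>i j. inner (e i) (e j) = (if i = j then 1 else 0)"
  shows "inner (e i) (\<Sum>j\<in>UNIV. a j *\<^sub>R e j) = a i"
  by (simp add: inner_sum_right assms if_distrib[of "(*) (a _)"] cong: if_cong)

lemma diag_op_comp:
  assumes "\<And>i j. inner (e i) (e j) = (if i = j then 1 else 0)"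
  shows "diag_op e c \<circ> diag_op e d = diag_op e (\<lambda>i. c i * d i)"
  by (simp add: fun_eq_iff diag_op_def inner_orthonormal_sum[OF assms] mult.assoc)

lemma inner_L2_nonneg: "0 \<le> (f :: L2) \<Longrightarrow> 0 \<le> g \<Longrightarrow> 0 \<le> inner f g"
  by transfer (intro integral_nonneg_AE, erule (1) eventually_elim2, simp)

lemma positive_diag_op:
  fixes e :: "'n::finite \<Rightarrow> L2"
  assumes "\<And>i. 0 \<le> e i" and "\<And>i. 0 \<le> c i"
  shows "positive_operator (diag_op e c)"
  using bounded_linear.linear[OF bounded_linear_diag_op[of e c]] assms
  by (auto simp: positive_operator_def diag_op_def
      intro!: sum_nonneg scaleR_nonneg_nonneg mult_nonneg_nonneg inner_L2_nonneg)

definition embed_op :: "('n::finite \<Rightarrow> 'a::real_inner) \<Rightarrow> ('n \<Rightarrow> real) \<Rightarrow> real ^ 'n \<Rightarrow> 'a"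
  where "embed_op e c x = (\<Sum>i\<in>UNIV. (c i * x $ i) *\<^sub>R e i)"

lemma adjoint_embed_op: "adjoint (embed_op e c) = (\<lambda>f. \<chi> i. c i * inner (e i) f)"
  by (rule adjoint_unique)
    (auto simp: embed_op_def inner_sum_left inner_vec_def mult_ac)

lemma embed_op_adjoint_comp: "embed_op e c \<circ> adjoint (embed_op e c) = diag_op e (\<lambda>i. c i * c i)"
  by (simp add: adjoint_embed_op fun_eq_iff embed_op_def diag_op_def mult.assoc)

lemma adjoint_embed_op_comp:
  assumes "\<And>i j. inner (e i) (e j) = (if i = j then 1 else 0)"
  shows "adjoint (embed_op e c) \<circ> embed_op e c = (\<lambda>x. \<chi> i. c i * c i * x $ i)"
  by (simp add: adjoint_embed_op fun_eq_iff embed_op_def inner_orthonormal_sum[OF assms] mult.assoc)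

lemma positive_embed_op:
  fixes e :: "'n::finite \<Rightarrow> L2"
  assumes "\<And>i. 0 \<le> e i" and "\<And>i. 0 \<le> c i"
  shows "positive_operator (embed_op e c)"
proof -
  have "linear (embed_op e c)"
    by (rule linearI)
      (simp_all add: embed_op_def algebra_simps sum.distrib scaleR_sum_right)
  then show ?thesis
    using assms
    by (auto simp: positive_operator_def embed_op_def less_eq_vec_def
        intro!: sum_nonneg scaleR_nonneg_nonneg)
qed

theorem corollary3p2:
  fixes D :: "real ^ 'n ^ 'n"
  assumes "diagonal_matrix D" and "positive_operator ((*v) D)"
  shows "\<exists>X :: real ^ 'n \<Rightarrow> L2.
    positive_operator X \<and> adjoint X \<circ> X = (*v) D \<and>
    (\<exists>Y :: L2 \<Rightarrow> L2. positive_operator Y \<and> self_adjoint Y \<and> Y \<circ> Y = X \<circ> adjoint X)"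
proof -
  have d: "0 \<le> D $ i $ i" for i
    using assms positive_operator_diagonal_iff by blast
  obtain h :: "'n \<Rightarrow> nat" where h: "inj h"
    using finite_imp_inj_to_nat_seg[OF finite] by metis
  define e where "e i = normalized_indicator (h i)" for i
  define c where "c i = sqrt (D $ i $ i)" for i
  have e0: "0 \<le> e i" for i
    by (simp add: e_def normalized_indicator_nonneg)
  have on: "inner (e i) (e j) = (if i = j then 1 else 0)" for i j
    using h by (simp add: e_def normalized_indicator_orthonormal inj_eq)
  have c0: "0 \<le> c i" and cc: "c i * c i = D $ i $ i" for i
    using d by (simp_all add: c_def)
  have "adjoint (embed_op e c) \<circ> embed_op e c = (*v) D"
    by (simp add: adjoint_embed_op_comp[OF on] cc fun_eq_iff vec_eq_iff
        diagonal_matrix_mult_nth[OF assms(1)])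
  moreover
  \<comment> \<open>\<open>XX\<^sup>*\<close> has the squares of the coefficients of \<open>X\<close>, so \<open>Y\<close> takes the coefficients of \<open>X\<close>.\<close>
  have "diag_op e c \<circ> diag_op e c = embed_op e c \<circ> adjoint (embed_op e c)"
    by (simp add: diag_op_comp[OF on] embed_op_adjoint_comp)
  ultimately show ?thesis
    using positive_embed_op[of e c] positive_diag_op[of e c] self_adjoint_diag_op[of e c] e0 c0
    by blast
qed

end
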